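(* Let $n\in\mathbb{N}$, let $A$ be a commutative ring, let $I$ be a finite totally ordered set, and let $\Lambda=(\lambda_i : i\in I)$ be a family of linear forms in $X=(X_0,\dots,X_n)$ with coefficients in $A$. Let $m=|I|-n$, and let $M_\Lambda$ be the square matrix of size $\binom{|I|}{n}\times\binom{|I|}{n}$ whose rows, indexed by the $m$-element subsets $\sigma\subseteq I$, are the coefficient vectors of $\Lambda^\sigma=\prod_{i\in\sigma}\lambda_i\in A[X]_m$, and whose columns are indexed by the monomials of degree $m$ in $X$ (rows and columns ordered as specified in the context). Then $$\det M_\Lambda=\prod_{\Lambda'}\det\Lambda',$$ where $\Lambda'$ ranges over all subfamilies of $\Lambda$ of size $n+1$ (indexed by the $(n+1)$-element subsets of $I$), each $\Lambda'$ is taken with the order induced from $I$, and $\det\Lambda'$ is the determinant of the $(n+1)\times(n+1)$ coefficient matrix of $\Lambda'$ (rows: the forms of $\Lambda'$ in increasing order; columns: $X_0,\dots,X_n$).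
   Context: $A[X]_m$ denotes the homogeneous polynomials of degree $m$ in $A[X]$. Order on monomials: monomials of degree $m$ in $X=(X_0,\dots,X_n)$ are ordered lexicographically, first comparing the exponent of $X_n$ (smaller exponent comes first), if these are equal comparing the exponent of $X_{n-1}$, and so on. In particular $X_0<X_1<\dots<X_n$. Order on subsets: the $m$-element subsets of the totally ordered set $I$ are ordered as follows: if $\sigma=\{s_0<\dots<s_{m-1}\}$ and $\tau=\{t_0<\dots<t_{m-1}\}$, then $\sigma<\tau$ if $s_{m-1}<t_{m-1}$, or if $s_{m-1}=t_{m-1}$ and $s_{m-2}<t_{m-2}$, and so on. The number of monomials of degree $m$ in $n+1$ indeterminates is $\binom{m+n}{n}$, which equals the number of $m$-element subsets of $I$. If $m<0$ (i.e. $|I|<n$), the matrix $M_\Lambda$ is empty and its determinant is $1$; if $m=0$ then $M_\Lambda=(1)$. *)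

theory Defs
  imports
    "HOL-Library.Poly_Mapping"
    "HOL-Library.List_Lexorder"
    "Jordan_Normal_Form.Determinant"
begin

text \<open>
  A monomial in \<open>X\<^sub>0, X\<^sub>1, \<dots>\<close> is its finitely supported exponent vector, and a polynomial is the
  finitely supported family of its coefficients, with the convolution product of \<open>Poly_Mapping\<close>.
\<close>

type_synonym monomial = "nat \<Rightarrow>\<^sub>0 nat"
type_synonym 'a mpoly = "monomial \<Rightarrow>\<^sub>0 'a"

text \<open>Degrees are integers, so that nothing has degree \<open>|I| - n\<close> when \<open>|I| < n\<close>.\<close>

definition monomials :: "nat \<Rightarrow> int \<Rightarrow> monomial set" where
  "monomials n m = {e. Poly_Mapping.keys e \<subseteq> {..n} \<and> int (\<Sum>j\<le>n. Poly_Mapping.lookup e j) = m}"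

definition homogeneous :: "nat \<Rightarrow> int \<Rightarrow> 'a::zero mpoly set" where
  "homogeneous n m = {p. Poly_Mapping.keys p \<subseteq> monomials n m}"

abbreviation linear_form :: "nat \<Rightarrow> 'a::zero mpoly \<Rightarrow> bool" where
  "linear_form n p \<equiv> p \<in> homogeneous n 1"

abbreviation indeterminate :: "nat \<Rightarrow> monomial" where
  "indeterminate j \<equiv> Poly_Mapping.single j 1"

definition subsets_of_size :: "'i set \<Rightarrow> int \<Rightarrow> 'i set set" where
  "subsets_of_size I m = {\<sigma>. \<sigma> \<subseteq> I \<and> finite \<sigma> \<and> int (card \<sigma>) = m}"

text \<open>
  Both orders compare from the top index downwards. They are therefore the lexicographic list
  orders of the exponents \<open>[e\<^sub>n, \<dots>, e\<^sub>0]\<close> and of the elements \<open>[s\<^bsub>m-1\<^esub>, \<dots>, s\<^sub>0]\<close> of a subset listed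
  in decreasing order.
\<close>

definition monomial_key :: "nat \<Rightarrow> monomial \<Rightarrow> nat list" where
  "monomial_key n e = rev (map (Poly_Mapping.lookup e) [0..<Suc n])"

definition subset_key :: "'i::linorder set \<Rightarrow> 'i list" where
  "subset_key \<sigma> = rev (sorted_list_of_set \<sigma>)"

definition monomial_list :: "nat \<Rightarrow> int \<Rightarrow> monomial list" where
  "monomial_list n m = sorted_key_list_of_set (monomial_key n) (monomials n m)"

definition subset_list :: "'i::linorder set \<Rightarrow> int \<Rightarrow> 'i set list" where
  "subset_list I m = sorted_key_list_of_set subset_key (subsets_of_size I m)"

definition product_matrix ::
    "nat \<Rightarrow> 'i::linorder set \<Rightarrow> ('i \<Rightarrow> 'a::comm_ring_1 mpoly) \<Rightarrow> 'a mat" where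
  "product_matrix n I \<Lambda> =
     (let m = int (card I) - int n; N = card I choose n in
      mat N N (\<lambda>(r, c).
        Poly_Mapping.lookup (\<Prod>i\<in>subset_list I m ! r. \<Lambda> i) (monomial_list n m ! c)))"

definition form_matrix ::
    "nat \<Rightarrow> 'i::linorder set \<Rightarrow> ('i \<Rightarrow> 'a::comm_ring_1 mpoly) \<Rightarrow> 'a mat" where
  "form_matrix n J \<Lambda> =
     mat (Suc n) (Suc n) (\<lambda>(r, c). Poly_Mapping.lookup (\<Lambda> (sorted_list_of_set J ! r)) (indeterminate c))"

text \<open>
  The two lists below enumerate the intended index sets without repetition, in increasing order,
  and have length \<open>|I| choose n\<close>.
\<close>

lemma inj_on_subset_key: "inj_on subset_key (subsets_of_size I m)"
  by (auto simp: inj_on_def subset_key_def subsets_of_size_def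
      dest: sorted_list_of_set_inject)

lemma inj_on_monomial_key: "inj_on (monomial_key n) (monomials n m)"
proof (rule inj_onI)
  fix e e' assume *: "e \<in> monomials n m" "e' \<in> monomials n m"
    and eq: "monomial_key n e = monomial_key n e'"
  from eq have le: "Poly_Mapping.lookup e j = Poly_Mapping.lookup e' j" if "j \<le> n" for j
    using that by (auto simp: monomial_key_def map_eq_conv simp del: upt_Suc)
  have "Poly_Mapping.lookup e j = Poly_Mapping.lookup e' j" if "\<not> j \<le> n" for j
  proof -
    have "j \<notin> Poly_Mapping.keys e" "j \<notin> Poly_Mapping.keys e'" using * that by (auto simp: monomials_def)
    then show ?thesis by (simp add: in_keys_iff)
  qed
  with le show "e = e'" by (metis poly_mapping_eqI)
qed

lemma monomial_key_image:
  "monomial_key n ` monomials n (int k) = {l. length l = Suc n \<and> sum_list l = k}"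
proof (intro equalityI subsetI)
  fix l assume "l \<in> monomial_key n ` monomials n (int k)"
  then obtain e where e: "e \<in> monomials n (int k)" and l: "l = monomial_key n e" by blast
  have "sum_list l = (\<Sum>j\<le>n. Poly_Mapping.lookup e j)"
    by (simp add: l monomial_key_def sum_list_rev interv_sum_list_conv_sum_set_nat
        atLeast0LessThan lessThan_Suc_atMost del: upt_Suc)
  with e show "l \<in> {l. length l = Suc n \<and> sum_list l = k}"
    by (auto simp: l monomials_def monomial_key_def simp flip: of_nat_sum)
next
  fix l assume "l \<in> {l. length l = Suc n \<and> sum_list l = k}"
  then have len: "length l = Suc n" and s: "sum_list l = k" by auto
  define f where "f j = (if j \<le> n then rev l ! j else 0)" for j
  have "finite {j. f j \<noteq> 0}"
    by (rule finite_subset[of _ "{..n}"]) (auto simp: f_def)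
  then have lk: "Poly_Mapping.lookup (Abs_poly_mapping f) = f" by (simp add: Abs_poly_mapping_inverse)
  have "(\<Sum>j\<le>n. f j) = (\<Sum>j<length (rev l). rev l ! j)"
    by (rule sum.cong) (auto simp: f_def len)
  also have "\<dots> = k"
    using sum_list_sum_nth[of "rev l"] s by (simp add: atLeast0LessThan)
  finally have "Abs_poly_mapping f \<in> monomials n (int k)"
    by (auto simp: monomials_def lk in_keys_iff f_def simp flip: of_nat_sum split: if_splits)
  moreover have "map f [0..<Suc n] = rev l"
    by (rule nth_equalityI) (auto simp: len f_def simp del: upt_Suc)
  then have "monomial_key n (Abs_poly_mapping f) = l"
    by (simp add: monomial_key_def lk del: upt_Suc)
  ultimately show "l \<in> monomial_key n ` monomials n (int k)" by force
qed

lemma monomials_negative: "m < 0 \<Longrightarrow> monomials n m = {}"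
  unfolding monomials_def using of_nat_0_le_iff[where 'a = int] by (auto simp: not_less[symmetric] simp del: of_nat_sum)

lemma card_monomials:
  "card (monomials n (int c - int n)) = c choose n"
proof (cases "c < n")
  case False
  then have m: "int c - int n = int (c - n)" by simp
  have "card (monomials n (int (c - n))) = card {l. length l = Suc n \<and> sum_list l = c - n}"
    by (simp add: card_image[OF inj_on_monomial_key] flip: monomial_key_image)
  also have "\<dots> = c choose n"
    using False binomial_symmetric[of n c] by (simp add: card_length_sum_list)
  finally show ?thesis by (simp add: m)
qed (simp add: monomials_negative)

lemma card_subsets_of_size:
  assumes "finite I"
  shows "card (subsets_of_size I (int (card I) - int n)) = card I choose n"
proof (cases "card I < n")
  case False
  then have "subsets_of_size I (int (card I) - int n) = {\<sigma>. \<sigma> \<subseteq> I \<and> card \<sigma> = card I - n}"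
    using assms by (auto simp: subsets_of_size_def finite_subset)
  then show ?thesis using False assms binomial_symmetric[of n "card I"] by (simp add: n_subsets)
qed (auto simp: subsets_of_size_def)

lemma finite_monomials: "finite (monomials n m)"
proof (cases "m < 0")
  case False
  then obtain k where m: "m = int k" by (metis nat_0_le not_less)
  have "finite (monomial_key n ` monomials n m)"
    unfolding m monomial_key_image
    by (rule finite_subset[OF _ finite_lists_length_eq[of "{..k}" "Suc n"]])
      (auto intro: member_le_sum_list)
  then show ?thesis by (rule finite_imageD) (rule inj_on_monomial_key)
qed (simp add: monomials_negative)

lemma (in linorder) sorted_key_list_of_set_enumerates:
  fixes f :: "'b \<Rightarrow> 'a"
  assumes "inj_on f S" and "finite S"
  shows "set (sorted_key_list_of_set f S) = S"
    and "sorted_wrt (\<lambda>x y. f x < f y) (sorted_key_list_of_set f S)"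
    and "length (sorted_key_list_of_set f S) = card S"
proof -
  interpret E: folding_insort_key "(\<le>)" "(<)" S f
    by unfold_locales (rule assms(1))
  show "set (sorted_key_list_of_set f S) = S"
    using E.set_sorted_key_list_of_set[OF subset_refl assms(2)] .
  show "sorted_wrt (\<lambda>x y. f x < f y) (sorted_key_list_of_set f S)"
    using E.strict_sorted_key_list_of_set[OF subset_refl] by (simp add: sorted_wrt_map)
  show "length (sorted_key_list_of_set f S) = card S"
    using E.length_sorted_key_list_of_set[OF subset_refl] .
qed

lemma monomial_list:
  "set (monomial_list n m) = monomials n m"
  "sorted_wrt (\<lambda>e e'. monomial_key n e < monomial_key n e') (monomial_list n m)"
  "length (monomial_list n (int c - int n)) = c choose n"
  unfolding monomial_list_def
  using sorted_key_list_of_set_enumerates[OF inj_on_monomial_key finite_monomials]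
  by (simp_all add: card_monomials)

lemma subset_list:
  fixes I :: "'i::linorder set"
  assumes "finite I"
  shows "set (subset_list I m) = subsets_of_size I m"
    and "sorted_wrt (\<lambda>\<sigma> \<tau>. subset_key \<sigma> < subset_key \<tau>) (subset_list I m)"
    and "length (subset_list I (int (card I) - int n)) = card I choose n"
proof -
  have fin: "finite (subsets_of_size I m)" for m
    by (rule finite_subset[of _ "Pow I"]) (auto simp: subsets_of_size_def assms)
  note enum = sorted_key_list_of_set_enumerates[OF inj_on_subset_key fin]
  show "set (subset_list I m) = subsets_of_size I m"
    unfolding subset_list_def by (rule enum(1))
  show "sorted_wrt (\<lambda>\<sigma> \<tau>. subset_key \<sigma> < subset_key \<tau>) (subset_list I m)"
    unfolding subset_list_def by (rule enum(2))
  show "length (subset_list I (int (card I) - int n)) = card I choose n"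
    unfolding subset_list_def by (simp add: enum(3) card_subsets_of_size assms)
qed

end

theory Submission
  imports Defs
begin

text \<open>
  Let \<open>\<omega>\<close> be the largest index, \<open>a\<close> the coefficient of \<open>X\<^sub>n\<close> in \<open>\<lambda>\<^sub>\<omega>\<close> and \<open>c\<^sub>i\<close> that in \<open>\<lambda>\<^sub>i\<close>. The forms
  \<open>\<lambda>'\<^sub>i = a \<lambda>\<^sub>i - c\<^sub>i \<lambda>\<^sub>\<omega>\<close> do not involve \<open>X\<^sub>n\<close>, and \<open>a\<^sup>m \<Lambda>\<^sup>\<sigma> \<equiv> \<Lambda>'\<^sup>\<sigma>\<close> modulo \<open>\<lambda>\<^sub>\<omega>\<close> for \<open>\<omega> \<notin> \<sigma>\<close>. Expanding the
  rows in the family consisting of the monomials free of \<open>X\<^sub>n\<close> and of \<open>\<lambda>\<^sub>\<omega>\<close> times the monomials of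
  degree \<open>m - 1\<close>, which is triangular over the monomials, gives a block triangular matrix whose
  diagonal blocks are the matrix of \<open>\<Lambda>'\<close> in one variable less and the matrix of \<open>\<Lambda>\<close> without \<open>\<lambda>\<^sub>\<omega>\<close>.
  The same relation for the subfamilies of \<open>n + 1\<close> forms containing \<open>\<lambda>\<^sub>\<omega>\<close>, for which \<open>m = 1\<close>, yields the
  claim by induction, up to a power of \<open>a\<close>.

  To cancel that power over an arbitrary ring \<open>A\<close>, the induction runs over \<open>A[t]\<close>: with \<open>\<lambda>\<^sub>\<omega> + t\<^sup>N X\<^sub>n\<close> in
  place of \<open>\<lambda>\<^sub>\<omega>\<close> the coefficient \<open>a + t\<^sup>N\<close> is monic for large \<open>N\<close>, hence regular. So the two sides
  for \<open>\<Lambda>\<close> itself agree modulo \<open>t\<^sup>N\<close> for all large \<open>N\<close>, which makes them equal.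
\<close>

subsection \<open>Determinants and congruences\<close>

text \<open>The corresponding lemma of \<open>Jordan_Normal_Form\<close> is restricted to integral domains.\<close>

lemma det_block_upper_triangular:
  fixes A :: "'a::comm_ring_1 mat"
  assumes "A \<in> carrier_mat (p + q) (p + q)"
    and "\<And>i j. p \<le> i \<Longrightarrow> i < p + q \<Longrightarrow> j < p \<Longrightarrow> A $$ (i, j) = 0"
  shows "det A = det (mat p p (\<lambda>(i, j). A $$ (i, j))) * det (mat q q (\<lambda>(i, j). A $$ (i + p, j + p)))"
  using assms
proof (induction p arbitrary: A)
  case 0
  then have "mat q q (\<lambda>(i, j). A $$ (i + 0, j + 0)) = A" by (intro eq_matI) auto
  then show ?case by simp
next
  case (Suc p)
  let ?B = "mat (Suc p) (Suc p) (\<lambda>(i, j). A $$ (i, j))"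
  let ?C = "mat q q (\<lambda>(i, j). A $$ (i + Suc p, j + Suc p))"
  have cof: "cofactor A i 0 = cofactor ?B i 0 * det ?C" if "i < Suc p" for i
  proof -
    have "det (mat_delete A i 0) = det (mat p p (\<lambda>(r, c). mat_delete A i 0 $$ (r, c)))
        * det (mat q q (\<lambda>(r, c). mat_delete A i 0 $$ (r + p, c + p)))"
      using Suc.prems that by (intro Suc.IH) (auto simp: mat_delete_def)
    also have "mat p p (\<lambda>(r, c). mat_delete A i 0 $$ (r, c)) = mat_delete ?B i 0"
      using Suc.prems that by (intro eq_matI) (auto simp: mat_delete_def)
    also have "mat q q (\<lambda>(r, c). mat_delete A i 0 $$ (r + p, c + p)) = ?C"
      using Suc.prems that by (intro eq_matI) (auto simp: mat_delete_def)
    finally show ?thesis by (simp add: cofactor_def)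
  qed
  have "det A = (\<Sum>i<Suc p + q. A $$ (i, 0) * cofactor A i 0)"
    using Suc.prems(1) by (intro laplace_expansion_column) auto
  also have "\<dots> = (\<Sum>i<Suc p. A $$ (i, 0) * cofactor A i 0)"
    using Suc.prems(2) by (intro sum.mono_neutral_right) auto
  also have "\<dots> = (\<Sum>i<Suc p. ?B $$ (i, 0) * cofactor ?B i 0) * det ?C"
    unfolding sum_distrib_right by (intro sum.cong) (auto simp: cof mult.assoc)
  also have "(\<Sum>i<Suc p. ?B $$ (i, 0) * cofactor ?B i 0) = det ?B"
    by (rule laplace_expansion_column[symmetric]) auto
  finally show ?case .
qed

lemma det_scale_rows:
  fixes A :: "'a::comm_ring_1 mat"
  assumes "A \<in> carrier_mat N N"
  shows "det (mat N N (\<lambda>(i, j). d i * A $$ (i, j))) = (\<Prod>i<N. d i) * det A"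
proof -
  have "(\<Prod>i = 0..<N. mat N N (\<lambda>(i, j). d i * A $$ (i, j)) $$ (i, p i))
      = (\<Prod>i<N. d i) * (\<Prod>i = 0..<N. A $$ (i, p i))" if "p permutes {0..<N}" for p
  proof -
    have "p i < N" if "i < N" for i using permutes_in_image[OF \<open>p permutes _\<close>] that by auto
    then have "(\<Prod>i = 0..<N. mat N N (\<lambda>(i, j). d i * A $$ (i, j)) $$ (i, p i))
        = (\<Prod>i = 0..<N. d i * A $$ (i, p i))"
      by (intro prod.cong) auto
    then show ?thesis by (simp add: prod.distrib lessThan_atLeast0)
  qed
  then show ?thesis
    by (simp add: det_def'[OF mat_carrier] det_def'[OF assms] sum_distrib_left mult.left_commute)
qed

lemma dvd_mult_diff:
  fixes d :: "'a::comm_ring_1"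
  assumes "d dvd x - x'" "d dvd y - y'"
  shows "d dvd x * y - x' * y'"
proof -
  have "x * y - x' * y' = (x - x') * y + x' * (y - y')" by (simp add: algebra_simps)
  with assms show ?thesis by simp
qed

lemma dvd_prod_diff:
  fixes d :: "'a::comm_ring_1"
  assumes "\<And>i. i \<in> S \<Longrightarrow> d dvd f i - g i"
  shows "d dvd (\<Prod>i\<in>S. f i) - (\<Prod>i\<in>S. g i)"
  using assms by (induction S rule: infinite_finite_induct) (auto intro!: dvd_mult_diff)

text \<open>The Leibniz formula is polynomial in the entries, so congruences modulo \<open>d\<close>
  survive term by term. With \<open>d\<close> a power of t this compares a perturbed family with the
  original one.\<close>

lemma dvd_det_diff:
  fixes d :: "'a::comm_ring_1"
  assumes "A \<in> carrier_mat N N" "B \<in> carrier_mat N N"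
    and "\<And>i j. i < N \<Longrightarrow> j < N \<Longrightarrow> d dvd A $$ (i, j) - B $$ (i, j)"
  shows "d dvd det A - det B"
  unfolding det_def'[OF assms(1)] det_def'[OF assms(2)] sum_subtractf[symmetric]
proof (rule dvd_sum)
  fix p assume "p \<in> {p. p permutes {0..<N}}"
  then have "p i < N" if "i < N" for i using permutes_in_image[of p "{0..<N}"] that by auto
  then show "d dvd signof p * (\<Prod>i = 0..<N. A $$ (i, p i)) - signof p * (\<Prod>i = 0..<N. B $$ (i, p i))"
    by (intro dvd_mult_diff dvd_prod_diff) (auto intro: assms(3))
qed

subsection \<open>Monoid algebras\<close>

lemma lookup_single_times:
  fixes p :: "'k::cancel_comm_monoid_add \<Rightarrow>\<^sub>0 'a::comm_ring_1"
  shows "Poly_Mapping.lookup (Poly_Mapping.single k c * p) (k + e) = c * Poly_Mapping.lookup p e"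
  by (simp add: lookup_mult lookup_single when_mult)

lemma lookup_const_times:
  fixes p :: "'k::cancel_comm_monoid_add \<Rightarrow>\<^sub>0 'a::comm_ring_1"
  shows "Poly_Mapping.lookup (Poly_Mapping.single 0 c * p) e = c * Poly_Mapping.lookup p e"
  using lookup_single_times[of 0 c p e] by simp

lemma poly_mapping_sum_singles:
  assumes "Poly_Mapping.keys p \<subseteq> S" "finite S"
  shows "p = (\<Sum>e\<in>S. Poly_Mapping.single e (Poly_Mapping.lookup p e))"
proof (rule poly_mapping_eqI)
  fix e
  show "Poly_Mapping.lookup p e = Poly_Mapping.lookup (\<Sum>e\<in>S. Poly_Mapping.single e (Poly_Mapping.lookup p e)) e"
    using assms by (auto simp: lookup_sum lookup_single when_def sum.delta in_keys_iff subset_iff)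
qed

lemma single_prod:
  "finite S \<Longrightarrow> (\<Prod>i\<in>S. Poly_Mapping.single (k i) (c i))
    = Poly_Mapping.single (\<Sum>i\<in>S. k i) (\<Prod>i\<in>S. c i :: 'a::comm_ring_1)"
  by (induction S rule: finite_induct) (simp_all add: mult_single)

text \<open>Summing over arbitrary finite supersets of the supports lets \<open>p\<close> and its
  image under a ring homomorphism, whose support may shrink, be compared over the same index
  sets.\<close>

lemma lookup_mult_finite:
  fixes p q :: "'k::comm_monoid_add \<Rightarrow>\<^sub>0 'a::comm_ring_1"
  assumes "Poly_Mapping.keys p \<subseteq> S" "finite S" "Poly_Mapping.keys q \<subseteq> T" "finite T"
  shows "Poly_Mapping.lookup (p * q) e
    = (\<Sum>a\<in>S. \<Sum>b\<in>T. Poly_Mapping.lookup p a * Poly_Mapping.lookup q b when a + b = e)"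
  by (subst poly_mapping_sum_singles[OF assms(1,2)], subst poly_mapping_sum_singles[OF assms(3,4)])
    (simp add: sum_product mult_single lookup_sum lookup_single)

lemma lookup_map_hom:
  assumes "comm_ring_hom h"
  shows "Poly_Mapping.lookup (Poly_Mapping.map h p) e = h (Poly_Mapping.lookup p e)"
proof -
  interpret comm_ring_hom h by fact
  show ?thesis by (simp add: map.rep_eq when_def)
qed

lemma map_hom_mult:
  fixes p q :: "'k::comm_monoid_add \<Rightarrow>\<^sub>0 'a::comm_ring_1"
  assumes "comm_ring_hom h"
  shows "Poly_Mapping.map h (p * q) = Poly_Mapping.map h p * Poly_Mapping.map h q"
proof (rule poly_mapping_eqI)
  interpret comm_ring_hom h by fact
  have keys: "Poly_Mapping.keys (Poly_Mapping.map h r) \<subseteq> Poly_Mapping.keys r" for r :: "'k \<Rightarrow>\<^sub>0 'a"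
    by (auto simp: in_keys_iff lookup_map_hom[OF assms])
  fix e
  have "Poly_Mapping.lookup (Poly_Mapping.map h (p * q)) e
      = h (\<Sum>a\<in>Poly_Mapping.keys p. \<Sum>b\<in>Poly_Mapping.keys q.
          Poly_Mapping.lookup p a * Poly_Mapping.lookup q b when a + b = e)"
    by (simp add: lookup_map_hom[OF assms] lookup_mult_finite[OF order_refl finite_keys order_refl finite_keys])
  also have "\<dots> = (\<Sum>a\<in>Poly_Mapping.keys p. \<Sum>b\<in>Poly_Mapping.keys q.
      h (Poly_Mapping.lookup p a) * h (Poly_Mapping.lookup q b) when a + b = e)"
    by (simp add: hom_sum hom_mult when_def if_distrib cong: if_cong)
  also have "\<dots> = Poly_Mapping.lookup (Poly_Mapping.map h p * Poly_Mapping.map h q) e"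
    by (simp add: lookup_mult_finite[OF keys finite_keys keys finite_keys] lookup_map_hom[OF assms])
  finally show "Poly_Mapping.lookup (Poly_Mapping.map h (p * q)) e
      = Poly_Mapping.lookup (Poly_Mapping.map h p * Poly_Mapping.map h q) e" .
qed

lemma map_hom_prod:
  fixes f :: "'i \<Rightarrow> 'k::comm_monoid_add \<Rightarrow>\<^sub>0 'a::comm_ring_1"
  assumes "comm_ring_hom h"
  shows "Poly_Mapping.map h (\<Prod>i\<in>S. f i) = (\<Prod>i\<in>S. Poly_Mapping.map h (f i))"
proof -
  interpret comm_ring_hom h by fact
  have "Poly_Mapping.map h (1 :: 'k \<Rightarrow>\<^sub>0 'a) = 1"
    by (rule poly_mapping_eqI) (simp add: lookup_map_hom[OF assms] lookup_one when_def)
  then show ?thesis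
    by (induction S rule: infinite_finite_induct) (simp_all add: map_hom_mult[OF assms])
qed

subsection \<open>Monomials and subsets in order\<close>

lemma homogeneousI: "(\<And>e. e \<notin> monomials n m \<Longrightarrow> Poly_Mapping.lookup p e = 0) \<Longrightarrow> p \<in> homogeneous n m"
  by (auto simp: homogeneous_def in_keys_iff)

lemma homogeneousD: "p \<in> homogeneous n m \<Longrightarrow> e \<notin> monomials n m \<Longrightarrow> Poly_Mapping.lookup p e = 0"
  by (auto simp: homogeneous_def in_keys_iff)

lemma monomials_add:
  assumes "e \<in> monomials n m" "e' \<in> monomials n m'"
  shows "e + e' \<in> monomials n (m + m')"
  using assms keys_add[of e e'] by (auto simp: monomials_def lookup_add sum.distrib)

lemma zero_homogeneous: "0 \<in> homogeneous n m"
  by (simp add: homogeneous_def)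

lemma add_homogeneous: "p \<in> homogeneous n m \<Longrightarrow> q \<in> homogeneous n m \<Longrightarrow> p + q \<in> homogeneous n m"
  by (auto intro!: homogeneousI simp: lookup_add homogeneousD)

lemma diff_homogeneous:
  fixes p :: "'a::comm_ring_1 mpoly"
  shows "p \<in> homogeneous n m \<Longrightarrow> q \<in> homogeneous n m \<Longrightarrow> p - q \<in> homogeneous n m"
  by (auto intro!: homogeneousI simp: lookup_minus homogeneousD)

lemma const_times_homogeneous:
  fixes p :: "'a::comm_ring_1 mpoly"
  shows "p \<in> homogeneous n m \<Longrightarrow> Poly_Mapping.single 0 c * p \<in> homogeneous n m"
  by (auto intro!: homogeneousI simp: lookup_const_times homogeneousD)

lemma mult_homogeneous:
  fixes p q :: "'a::comm_ring_1 mpoly"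
  assumes "p \<in> homogeneous n m" "q \<in> homogeneous n m'"
  shows "p * q \<in> homogeneous n (m + m')"
  using assms keys_mult[of p q] by (fastforce simp: homogeneous_def intro: monomials_add)

lemma prod_linear_homogeneous:
  fixes f :: "'i \<Rightarrow> 'a::comm_ring_1 mpoly"
  assumes "finite S" "\<And>i. i \<in> S \<Longrightarrow> linear_form n (f i)"
  shows "(\<Prod>i\<in>S. f i) \<in> homogeneous n (int (card S))"
  using assms
proof (induction S rule: finite_induct)
  case empty
  then show ?case by (auto simp: homogeneous_def monomials_def)
next
  case (insert i S)
  then show ?case using mult_homogeneous[of "f i" n 1 "prod f S" "int (card S)"] by (simp add: add.commute)
qed

text \<open>Reduces the recursions for the two enumerations to an equality of sets and a check of
  the order.\<close>

lemma strictly_sorted_by_key_unique: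
  fixes f :: "'b \<Rightarrow> 'c::linorder"
  assumes "sorted_wrt (\<lambda>x y. f x < f y) xs" "sorted_wrt (\<lambda>x y. f x < f y) ys" "set xs = set ys"
    and "inj_on f (set xs)"
  shows "xs = ys"
proof -
  have "map f xs = map f ys"
    using assms(1,2,3) by (intro strict_sorted_equal) (simp_all add: sorted_wrt_map)
  with assms(3,4) show ?thesis by (simp add: inj_on_map_eq_map)
qed

section \<open>Monomials: splitting off the last indeterminate\<close>

lemma monomial_key_Suc: "monomial_key (Suc k) e = Poly_Mapping.lookup e (Suc k) # monomial_key k e"
  by (simp add: monomial_key_def)

lemma monomial_key_add_top:
  "monomial_key k (indeterminate (Suc k) + e) = monomial_key k e"
  by (simp add: monomial_key_def lookup_add lookup_single del: upt_Suc)

lemma monomials_lookup_beyond: "e \<in> monomials k m \<Longrightarrow> k < j \<Longrightarrow> Poly_Mapping.lookup e j = 0"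
  by (auto simp: monomials_def in_keys_iff subset_iff)

lemma indeterminate_monomials: "j \<le> n \<Longrightarrow> indeterminate j \<in> monomials n 1"
  by (auto simp: monomials_def lookup_single when_def simp del: of_nat_sum)

lemma monomials_1: "monomials n 1 = indeterminate ` {..n}"
proof (intro equalityI subsetI)
  fix e assume e: "e \<in> monomials n 1"
  then have "(\<Sum>j\<le>n. Poly_Mapping.lookup e j) = 1" by (simp add: monomials_def flip: of_nat_sum)
  then obtain j where j: "j \<le> n" "Poly_Mapping.lookup e j = 1"
    and 0: "\<And>i. i \<le> n \<Longrightarrow> i \<noteq> j \<Longrightarrow> Poly_Mapping.lookup e i = 0"
    using sum_eq_1_iff[of "{..n}" "Poly_Mapping.lookup e"] by auto
  have "e = indeterminate j"
  proof (rule poly_mapping_eqI)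
    fix i show "Poly_Mapping.lookup e i = Poly_Mapping.lookup (indeterminate j) i"
      using j 0[of i] monomials_lookup_beyond[OF e, of i] by (cases "i \<le> n") (auto simp: lookup_single when_def)
  qed
  with j(1) show "e \<in> indeterminate ` {..n}" by blast
qed (use indeterminate_monomials in auto)

lemma monomials_Suc:
  "monomials (Suc k) m = monomials k m \<union> (+) (indeterminate (Suc k)) ` monomials (Suc k) (m - 1)"
proof (intro equalityI subsetI)
  fix e assume e: "e \<in> monomials (Suc k) m"
  show "e \<in> monomials k m \<union> (+) (indeterminate (Suc k)) ` monomials (Suc k) (m - 1)"
  proof (cases "Poly_Mapping.lookup e (Suc k) = 0")
    case True
    with e have "e \<in> monomials k m"
      by (auto simp: monomials_def in_keys_iff subset_iff) (metis le_SucE not_gr_zero)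
    then show ?thesis by blast
  next
    case False
    \<comment> \<open>Subtraction of exponents is truncated, but here X_{k+1} divides the monomial,
      so nothing is lost.\<close>
    define e' where "e' = e - indeterminate (Suc k)"
    have ee': "e = indeterminate (Suc k) + e'"
      using False by (intro poly_mapping_eqI) (auto simp: e'_def lookup_add lookup_minus lookup_single when_def)
    have "Poly_Mapping.keys e' \<subseteq> {..Suc k}"
      using e by (auto simp: monomials_def e'_def in_keys_iff lookup_minus subset_iff simp del: of_nat_sum)
    moreover have "(\<Sum>j\<le>Suc k. Poly_Mapping.lookup e j) = 1 + (\<Sum>j\<le>Suc k. Poly_Mapping.lookup e' j)"
      unfolding ee' lookup_add sum.distrib by (simp add: lookup_single when_def)
    ultimately have "e' \<in> monomials (Suc k) (m - 1)"
      using e by (auto simp: monomials_def simp del: sum.atMost_Suc of_nat_sum)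
    with ee' show ?thesis by blast
  qed
next
  fix e assume "e \<in> monomials k m \<union> (+) (indeterminate (Suc k)) ` monomials (Suc k) (m - 1)"
  then show "e \<in> monomials (Suc k) m"
  proof
    assume "e \<in> monomials k m"
    then show ?thesis
      by (auto simp: monomials_def in_keys_iff subset_iff intro: le_SucI)
  next
    assume "e \<in> (+) (indeterminate (Suc k)) ` monomials (Suc k) (m - 1)"
    then show ?thesis
      using monomials_add[OF indeterminate_monomials[of "Suc k" "Suc k"]] by fastforce
  qed
qed

lemma homogeneous_Suc_vars: "p \<in> homogeneous k m \<Longrightarrow> p \<in> homogeneous (Suc k) m"
  using monomials_Suc[of k m] by (auto simp: homogeneous_def)

text \<open>Monomials free of X_{k+1} have first key entry 0 and precede all its multiples.
  Multiplication by X_{k+1} raises that entry by one and keeps the others, so it preserves the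
  order.\<close>

lemma monomial_list_Suc:
  "monomial_list (Suc k) m
    = monomial_list k m @ map ((+) (indeterminate (Suc k))) (monomial_list (Suc k) (m - 1))"
proof (rule strictly_sorted_by_key_unique[where f = "monomial_key (Suc k)"])
  show "sorted_wrt (\<lambda>x y. monomial_key (Suc k) x < monomial_key (Suc k) y) (monomial_list (Suc k) m)"
    by (rule monomial_list(2))
  show "inj_on (monomial_key (Suc k)) (set (monomial_list (Suc k) m))"
    by (simp add: monomial_list(1) inj_on_monomial_key)
  show "set (monomial_list (Suc k) m)
      = set (monomial_list k m @ map ((+) (indeterminate (Suc k))) (monomial_list (Suc k) (m - 1)))"
    by (simp add: monomial_list(1) monomials_Suc[of k m])
  have "sorted_wrt (\<lambda>x y. monomial_key (Suc k) x < monomial_key (Suc k) y) (monomial_list k m)"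
    by (rule sorted_wrt_mono_rel[OF _ monomial_list(2)])
      (auto simp: monomial_list(1) monomial_key_Suc monomials_lookup_beyond)
  moreover have "sorted_wrt (\<lambda>x y. monomial_key (Suc k) x < monomial_key (Suc k) y)
      (map ((+) (indeterminate (Suc k))) (monomial_list (Suc k) (m - 1)))"
    unfolding sorted_wrt_map
    by (rule sorted_wrt_mono_rel[OF _ monomial_list(2)])
      (use monomial_key_add_top in \<open>auto simp: monomial_key_Suc lookup_add\<close>)
  ultimately show "sorted_wrt (\<lambda>x y. monomial_key (Suc k) x < monomial_key (Suc k) y)
      (monomial_list k m @ map ((+) (indeterminate (Suc k))) (monomial_list (Suc k) (m - 1)))"
    by (auto simp: sorted_wrt_append monomial_list(1) monomial_key_Suc lookup_add monomials_lookup_beyond)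
qed

section \<open>Subsets: splitting off the largest index\<close>

lemma subset_key_insert_top:
  assumes "finite \<sigma>" "\<And>i. i \<in> \<sigma> \<Longrightarrow> i < \<omega>"
  shows "subset_key (insert \<omega> \<sigma>) = \<omega> # subset_key \<sigma>"
proof -
  have "\<omega> \<notin> \<sigma>" using assms(2) by blast
  then have "sorted_list_of_set (insert \<omega> \<sigma>) = insort \<omega> (sorted_list_of_set \<sigma>)"
    using assms(1) by simp
  also have "\<dots> = sorted_list_of_set \<sigma> @ [\<omega>]"
    using assms by (intro sorted_insort_is_snoc) (auto simp: less_imp_le)
  finally have "sorted_list_of_set (insert \<omega> \<sigma>) = sorted_list_of_set \<sigma> @ [\<omega>]" .
  then show ?thesis by (simp add: subset_key_def)
qed

lemma subset_key_less_Cons: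
  assumes "finite \<sigma>" "\<And>i. i \<in> \<sigma> \<Longrightarrow> i < \<omega>"
  shows "subset_key \<sigma> < \<omega> # l"
proof (cases "subset_key \<sigma>")
  case (Cons i l')
  then have "i \<in> \<sigma>" using assms(1) by (metis list.set_intros(1) set_rev set_sorted_list_of_set subset_key_def)
  with Cons assms(2) show ?thesis by simp
qed simp

lemma subsets_of_size_insert:
  assumes "\<omega> \<notin> I"
  shows "subsets_of_size (insert \<omega> I) m = subsets_of_size I m \<union> insert \<omega> ` subsets_of_size I (m - 1)"
proof (intro equalityI subsetI)
  fix \<sigma> assume \<sigma>: "\<sigma> \<in> subsets_of_size (insert \<omega> I) m"
  show "\<sigma> \<in> subsets_of_size I m \<union> insert \<omega> ` subsets_of_size I (m - 1)"
  proof (cases "\<omega> \<in> \<sigma>")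
    case True
    with \<sigma> have "\<sigma> - {\<omega>} \<in> subsets_of_size I (m - 1)"
      using card_Suc_Diff1[of \<sigma> \<omega>] by (auto simp: subsets_of_size_def simp del: card_Diff_insert)
    moreover have "\<sigma> = insert \<omega> (\<sigma> - {\<omega>})" using True by blast
    ultimately show ?thesis by blast
  qed (use \<sigma> in \<open>auto simp: subsets_of_size_def\<close>)
next
  fix \<sigma> assume "\<sigma> \<in> subsets_of_size I m \<union> insert \<omega> ` subsets_of_size I (m - 1)"
  then show "\<sigma> \<in> subsets_of_size (insert \<omega> I) m"
    using assms by (auto simp: subsets_of_size_def card_insert_if)
qed

text \<open>Keys start with the largest element, so every subset without \<open>\<omega>\<close>
  precedes those containing it. For m = |I| - k the resulting row blocks have the same sizes as the
  column blocks of \<open>monomial_list_Suc\<close>.\<close>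

lemma subset_list_insert:
  assumes "finite I" "\<And>i. i \<in> I \<Longrightarrow> i < \<omega>"
  shows "subset_list (insert \<omega> I) m = subset_list I m @ map (insert \<omega>) (subset_list I (m - 1))"
proof (rule strictly_sorted_by_key_unique[where f = subset_key])
  have \<omega>: "\<omega> \<notin> I" using assms(2) by blast
  have fin: "finite (insert \<omega> I)" using assms(1) by simp
  have top: "subset_key (insert \<omega> \<sigma>) = \<omega> # subset_key \<sigma>" "subset_key \<sigma> < \<omega> # l"
    if "\<sigma> \<in> subsets_of_size I m'" for \<sigma> m' l
    using that assms(2)
    by (auto simp: subsets_of_size_def intro!: subset_key_insert_top subset_key_less_Cons)
  show "sorted_wrt (\<lambda>x y. subset_key x < subset_key y) (subset_list (insert \<omega> I) m)"
    by (rule subset_list(2)[OF fin])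
  show "inj_on subset_key (set (subset_list (insert \<omega> I) m))"
    by (simp add: subset_list(1)[OF fin] inj_on_subset_key)
  show "set (subset_list (insert \<omega> I) m) = set (subset_list I m @ map (insert \<omega>) (subset_list I (m - 1)))"
    by (simp add: subset_list(1)[OF fin] subset_list(1)[OF assms(1)] subsets_of_size_insert[OF \<omega>])
  have "sorted_wrt (\<lambda>x y. subset_key x < subset_key y) (map (insert \<omega>) (subset_list I (m - 1)))"
    unfolding sorted_wrt_map
    by (rule sorted_wrt_mono_rel[OF _ subset_list(2)[OF assms(1)]])
      (simp add: subset_list(1)[OF assms(1)] top)
  with subset_list(2)[OF assms(1)]
  show "sorted_wrt (\<lambda>x y. subset_key x < subset_key y)
      (subset_list I m @ map (insert \<omega>) (subset_list I (m - 1)))"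
    by (auto simp: sorted_wrt_append subset_list(1)[OF assms(1)] top)
qed

subsection \<open>Splitting off the last form\<close>

lemma distinct_monomial_list: "distinct (monomial_list n m)"
  using monomial_list(2)[of n m] strict_sorted_iff[of "map (monomial_key n) (monomial_list n m)"]
  by (simp add: sorted_wrt_map distinct_map)

lemma sum_monomials_nth:
  "(\<Sum>e\<in>monomials n m. f e) = (\<Sum>j<length (monomial_list n m). f (monomial_list n m ! j))"
  using sum.reindex_bij_betw[OF bij_betw_nth[OF distinct_monomial_list refl monomial_list(1)[symmetric]]]
  by (rule sym)

lemma lookup_mult_single_1:
  fixes p :: "'k::cancel_comm_monoid_add \<Rightarrow>\<^sub>0 'a::comm_ring_1"
  shows "Poly_Mapping.lookup (p * Poly_Mapping.single e 1) (d + e) = Poly_Mapping.lookup p d"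
  using lookup_single_times[of e 1 p d] by (simp add: ac_simps)

text \<open>The right-hand side is a row of coefficients of \<open>p\<close> and \<open>q\<close>
  times a column that depends only on \<open>L\<close> and \<open>f\<close>. This is the source of
  the matrix factorization below.\<close>

lemma lookup_basis_expansion:
  fixes L :: "'a::comm_ring_1 mpoly"
  assumes "p \<in> homogeneous k m" "q \<in> homogeneous n m'"
  shows "Poly_Mapping.lookup (p + L * q) f
    = (\<Sum>e\<in>monomials k m. Poly_Mapping.lookup p e * Poly_Mapping.lookup (Poly_Mapping.single e 1) f)
    + (\<Sum>e\<in>monomials n m'. Poly_Mapping.lookup q e * Poly_Mapping.lookup (L * Poly_Mapping.single e 1) f)"
proof -
  have "Poly_Mapping.lookup p f
      = Poly_Mapping.lookup (\<Sum>e\<in>monomials k m. Poly_Mapping.single e (Poly_Mapping.lookup p e)) f"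
    using assms(1) poly_mapping_sum_singles[OF _ finite_monomials, of p k m] by (simp add: homogeneous_def)
  also have "\<dots> = (\<Sum>e\<in>monomials k m. Poly_Mapping.lookup p e * Poly_Mapping.lookup (Poly_Mapping.single e 1) f)"
    by (simp add: lookup_sum lookup_single mult_when)
  finally have p: "Poly_Mapping.lookup p f = \<dots>" .
  have single: "L * Poly_Mapping.single e c = Poly_Mapping.single 0 c * (L * Poly_Mapping.single e 1)" for e c
    by (simp add: mult_single mult.left_commute)
  have "Poly_Mapping.lookup (L * q) f
      = Poly_Mapping.lookup (L * (\<Sum>e\<in>monomials n m'. Poly_Mapping.single e (Poly_Mapping.lookup q e))) f"
    using assms(2) poly_mapping_sum_singles[OF _ finite_monomials, of q n m'] by (simp add: homogeneous_def)
  also have "\<dots> = (\<Sum>e\<in>monomials n m'. Poly_Mapping.lookup (L * Poly_Mapping.single e (Poly_Mapping.lookup q e)) f)"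
    by (simp add: sum_distrib_left lookup_sum)
  also have "\<dots> = (\<Sum>e\<in>monomials n m'. Poly_Mapping.lookup q e * Poly_Mapping.lookup (L * Poly_Mapping.single e 1) f)"
    by (subst single) (simp add: lookup_const_times)
  finally show ?thesis by (simp add: p lookup_add)
qed

lemma prod_if_less:
  "(\<Prod>i<P + Q. if i < P then c else d) = c ^ P * d ^ Q" for c d :: "'a::comm_monoid_mult"
  by (induction Q) (simp_all add: ac_simps)

text \<open>All monomials of L X^e have the form X_j X^e, and the largest of these is X_{k+1} X^e.
  Hence X_{k+1} X^{e'} with e' above e cannot occur.\<close>

lemma lookup_linear_times_above:
  fixes L :: "'a::comm_ring_1 mpoly"
  assumes "linear_form (Suc k) L" "monomial_key (Suc k) e < monomial_key (Suc k) e'"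
  shows "Poly_Mapping.lookup (L * Poly_Mapping.single e 1) (indeterminate (Suc k) + e') = 0"
proof (rule ccontr)
  assume "\<not> ?thesis"
  then have "indeterminate (Suc k) + e' \<in> Poly_Mapping.keys (L * Poly_Mapping.single e 1)"
    by (simp add: in_keys_iff)
  then obtain d where "d \<in> Poly_Mapping.keys L" and d: "indeterminate (Suc k) + e' = d + e"
    using keys_mult[of L "Poly_Mapping.single e 1"] by (auto split: if_splits)
  then have "d \<in> indeterminate ` {..Suc k}"
    using assms(1) by (auto simp: homogeneous_def monomials_1)
  then obtain j where j: "j \<le> Suc k" "d = indeterminate j" by blast
  show False
  proof (cases "j = Suc k")
    case True
    with d j show False using assms(2) by simp
  next
    case False
    \<comment> \<open>For j <= k the factor X_j leaves the exponent of X_{k+1} alone, so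
      \<open>e'\<close> would have a smaller top exponent than \<open>e\<close> and precede
      it.\<close>
    have "Suc (Poly_Mapping.lookup e' (Suc k)) = Poly_Mapping.lookup e (Suc k)"
      using arg_cong[OF d, of "\<lambda>e. Poly_Mapping.lookup e (Suc k)"] False j(2)
      by (simp add: lookup_add lookup_single when_def)
    with assms(2) show False by (simp add: monomial_key_Suc)
  qed
qed

text \<open>The matrix factors as \<open>N * T\<close>. The rows of \<open>T\<close> are the
  \<open>P\<close> monomials free of X_{k+1}, followed by \<open>L\<close> times the
  \<open>Q\<close> monomials of degree m - 1; \<open>N\<close> holds the coordinates in this family.
  The vanishing of \<open>b\<close> on the last \<open>Q\<close> rows makes \<open>N\<close> block
  triangular, and \<open>T\<close> is triangular with \<open>P\<close> ones and \<open>Q\<close>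
  copies of the top coefficient of \<open>L\<close> on the diagonal.\<close>

lemma det_coefficients_split:
  fixes L :: "'a::comm_ring_1 mpoly" and b s :: "nat \<Rightarrow> 'a mpoly" and k :: nat and m :: int
  defines "P \<equiv> length (monomial_list k m)" and "Q \<equiv> length (monomial_list (Suc k) (m - 1))"
  assumes L: "linear_form (Suc k) L"
    and b: "\<And>i. i < P \<Longrightarrow> b i \<in> homogeneous k m"
    and b0: "\<And>i. P \<le> i \<Longrightarrow> i < P + Q \<Longrightarrow> b i = 0"
    and s: "\<And>i. i < P + Q \<Longrightarrow> s i \<in> homogeneous (Suc k) (m - 1)"
  shows "det (mat (P + Q) (P + Q) (\<lambda>(i, j). Poly_Mapping.lookup (b i + L * s i) (monomial_list (Suc k) m ! j)))
    = det (mat P P (\<lambda>(i, j). Poly_Mapping.lookup (b i) (monomial_list k m ! j)))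
      * det (mat Q Q (\<lambda>(i, j). Poly_Mapping.lookup (s (i + P)) (monomial_list (Suc k) (m - 1) ! j)))
      * Poly_Mapping.lookup L (indeterminate (Suc k)) ^ Q"
proof -
  let ?E = "monomial_list (Suc k) m" and ?F = "monomial_list k m"
    and ?G = "monomial_list (Suc k) (m - 1)" and ?x = "indeterminate (Suc k)"
  define B where "B i = (if i < P then Poly_Mapping.single (?F ! i) 1
    else L * Poly_Mapping.single (?G ! (i - P)) (1 :: 'a))" for i
  define T where "T = mat (P + Q) (P + Q) (\<lambda>(i, j). Poly_Mapping.lookup (B i) (?E ! j))"
  define N where "N = mat (P + Q) (P + Q) (\<lambda>(i, j). if j < P then Poly_Mapping.lookup (b i) (?F ! j)
    else Poly_Mapping.lookup (s i) (?G ! (j - P)))"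
  have E: "?E ! j = (if j < P then ?F ! j else ?x + ?G ! (j - P))" if "j < P + Q" for j
    using that by (auto simp: monomial_list_Suc[of k m] nth_append P_def Q_def)
  have lenE: "length ?E = P + Q" by (simp add: monomial_list_Suc[of k m] P_def Q_def)
  have "mat (P + Q) (P + Q) (\<lambda>(i, j). Poly_Mapping.lookup (b i + L * s i) (?E ! j)) = N * T"
  proof (rule eq_matI)
    fix i j assume "i < dim_row (N * T)" "j < dim_col (N * T)"
    then have ij: "i < P + Q" "j < P + Q" by (auto simp: N_def T_def)
    have "b i \<in> homogeneous k m" using b b0 ij(1) zero_homogeneous by (metis not_less)
    then have "Poly_Mapping.lookup (b i + L * s i) (?E ! j)
      = (\<Sum>l<P. Poly_Mapping.lookup (b i) (?F ! l) * Poly_Mapping.lookup (Poly_Mapping.single (?F ! l) 1) (?E ! j))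
      + (\<Sum>l<Q. Poly_Mapping.lookup (s i) (?G ! l) * Poly_Mapping.lookup (L * Poly_Mapping.single (?G ! l) 1) (?E ! j))"
      by (subst lookup_basis_expansion[OF _ s[OF ij(1)]]) (simp_all add: sum_monomials_nth P_def Q_def)
    also have "\<dots> = (\<Sum>l<P. N $$ (i, l) * T $$ (l, j)) + (\<Sum>l<Q. N $$ (i, P + l) * T $$ (P + l, j))"
      using ij by (simp add: N_def T_def B_def)
    also have "\<dots> = (\<Sum>l = 0..<P + Q. N $$ (i, l) * T $$ (l, j))"
      using sum.atLeastLessThan_concat[of 0 P "P + Q" "\<lambda>l. N $$ (i, l) * T $$ (l, j)"]
        sum.shift_bounds_nat_ivl[of "\<lambda>l. N $$ (i, l) * T $$ (l, j)" 0 P Q]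
      by (simp add: lessThan_atLeast0 add.commute)
    finally show "mat (P + Q) (P + Q) (\<lambda>(i, j). Poly_Mapping.lookup (b i + L * s i) (?E ! j)) $$ (i, j)
        = (N * T) $$ (i, j)"
      using ij by (simp add: N_def T_def scalar_prod_def)
  qed (auto simp: N_def T_def)
  moreover have "det N = det (mat P P (\<lambda>(i, j). Poly_Mapping.lookup (b i) (?F ! j)))
      * det (mat Q Q (\<lambda>(i, j). Poly_Mapping.lookup (s (i + P)) (?G ! j)))"
  proof -
    have "det N = det (mat P P (\<lambda>(i, j). N $$ (i, j))) * det (mat Q Q (\<lambda>(i, j). N $$ (i + P, j + P)))"
      by (rule det_block_upper_triangular) (auto simp: N_def b0)
    also have "mat P P (\<lambda>(i, j). N $$ (i, j)) = mat P P (\<lambda>(i, j). Poly_Mapping.lookup (b i) (?F ! j))"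
      by (rule eq_matI) (auto simp: N_def)
    also have "mat Q Q (\<lambda>(i, j). N $$ (i + P, j + P))
        = mat Q Q (\<lambda>(i, j). Poly_Mapping.lookup (s (i + P)) (?G ! j))"
      by (rule eq_matI) (auto simp: N_def)
    finally show ?thesis .
  qed
  moreover have "det T = Poly_Mapping.lookup L ?x ^ Q"
  proof -
    have "T $$ (i, j) = 0" if ij: "i < j" "j < P + Q" for i j
    proof (cases "i < P")
      case True
      have "?E ! i \<noteq> ?E ! j"
        using ij distinct_monomial_list[of "Suc k" m] lenE by (simp add: nth_eq_iff_index_eq)
      then show ?thesis using True ij E[of i] by (simp add: T_def B_def lookup_single when_def)
    next
      case False
      then have "monomial_key (Suc k) (?G ! (i - P)) < monomial_key (Suc k) (?G ! (j - P))"
        using ij sorted_wrt_nth_less[OF monomial_list(2)[of "Suc k" "m - 1"], of "i - P" "j - P"]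
        by (simp add: Q_def)
      from lookup_linear_times_above[OF L this] False ij show ?thesis
        by (simp add: T_def B_def E)
    qed
    then have "det T = (\<Prod>i = 0..<P + Q. T $$ (i, i))"
      by (subst det_lower_triangular[of "P + Q"]) (auto simp: T_def prod_list_diag_prod)
    also have "\<dots> = (\<Prod>i<P + Q. if i < P then 1 else Poly_Mapping.lookup L ?x)"
      unfolding lessThan_atLeast0
      by (rule prod.cong) (auto simp: T_def B_def E lookup_mult_single_1)
    finally show ?thesis by (simp add: prod_if_less)
  qed
  moreover have "det (N * T) = det N * det T"
    by (rule det_mult[of _ "P + Q"]) (simp_all add: N_def T_def)
  ultimately show ?thesis by simp
qed

text \<open>When the product is multiplied out, every term except the product of the
  \<open>g i\<close> contains \<open>L\<close>. The degree of the cofactor \<open>q\<close> is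
  tracked so that its coefficients fit the columns of degree m - 1.\<close>

lemma prod_modulo_linear_form:
  fixes L :: "'a::comm_ring_1 mpoly"
  assumes "finite S" and L: "linear_form (Suc k) L"
    and "\<And>i. i \<in> S \<Longrightarrow> linear_form k (g i)"
    and "\<And>i. i \<in> S \<Longrightarrow> f i = g i + L * Poly_Mapping.single 0 (c i)"
  shows "\<exists>q \<in> homogeneous (Suc k) (int (card S) - 1). (\<Prod>i\<in>S. f i) = (\<Prod>i\<in>S. g i) + L * q"
  using assms(1,3,4)
proof (induction S rule: finite_induct)
  case empty
  \<comment> \<open>The cofactor of the empty product must have degree -1, where 0 is the only
    homogeneous element.\<close>
  show ?case by (rule bexI[of _ 0]) (simp_all add: zero_homogeneous)
next
  case (insert i S)
  then obtain q where q: "q \<in> homogeneous (Suc k) (int (card S) - 1)"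
    and f: "(\<Prod>i\<in>S. f i) = (\<Prod>i\<in>S. g i) + L * q" by auto
  \<comment> \<open>With G the product of \<open>g\<close> over \<open>S\<close>: (g_i + c_i L)(G +
    L q) = g_i G + L (g_i q + c_i (G + L q)).\<close>
  let ?q = "g i * q + Poly_Mapping.single 0 (c i) * ((\<Prod>i\<in>S. g i) + L * q)"
  have gi: "linear_form (Suc k) (g i)" using insert.prems by (auto intro: homogeneous_Suc_vars)
  have g: "(\<Prod>i\<in>S. g i) \<in> homogeneous (Suc k) (int (card S))"
    using insert by (intro homogeneous_Suc_vars prod_linear_homogeneous) auto
  have "?q \<in> homogeneous (Suc k) (int (card S))"
    using mult_homogeneous[OF gi q] mult_homogeneous[OF L q] g
    by (auto intro!: add_homogeneous const_times_homogeneous)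
  moreover have "(\<Prod>i\<in>insert i S. f i) = (\<Prod>i\<in>insert i S. g i) + L * ?q"
    unfolding prod.insert[OF insert.hyps] f insert.prems(2)[OF insertI1] by (simp add: algebra_simps)
  ultimately show ?case using insert.hyps by (intro bexI[of _ ?q]) auto
qed

lemma product_matrix_carrier:
  "product_matrix n I \<Lambda> \<in> carrier_mat (card I choose n) (card I choose n)"
  by (simp add: product_matrix_def Let_def)

lemma linear_form_reduced:
  fixes p L :: "'a::comm_ring_1 mpoly"
  assumes "linear_form (Suc k) p" "linear_form (Suc k) L"
  shows "linear_form k (Poly_Mapping.single 0 (Poly_Mapping.lookup L (indeterminate (Suc k))) * p
    - Poly_Mapping.single 0 (Poly_Mapping.lookup p (indeterminate (Suc k))) * L)" (is "linear_form k ?r")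
proof (rule homogeneousI)
  fix e assume e: "e \<notin> monomials k 1"
  have r: "linear_form (Suc k) ?r"
    using assms by (intro diff_homogeneous const_times_homogeneous)
  show "Poly_Mapping.lookup ?r e = 0"
  proof (cases "e \<in> monomials (Suc k) 1")
    case True
    with e have "e = indeterminate (Suc k)" by (auto simp: monomials_1 atMost_Suc)
    then show ?thesis by (simp add: lookup_minus lookup_const_times)
  qed (rule homogeneousD[OF r])
qed

text \<open>Rows without \<open>\<omega>\<close> are scaled by the m-th power of
  \<open>c \<omega>\<close> and then agree with products of the \<open>\<Lambda>'\<close> forms
  modulo \<open>\<Lambda> \<omega>\<close>; rows with \<open>\<omega>\<close> are already multiples
  of \<open>\<Lambda> \<omega>\<close>. There are \<open>card I choose k\<close> rows of the first
  kind, whence the power on the left. The power on the right is the determinant of the base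
  change.\<close>

lemma det_product_matrix_insert:
  fixes \<Lambda> :: "'i::linorder \<Rightarrow> 'a::comm_ring_1 mpoly" and k :: nat
  defines "c \<equiv> (\<lambda>i. Poly_Mapping.lookup (\<Lambda> i) (indeterminate (Suc k)))"
  assumes fin: "finite I" and top: "\<And>i. i \<in> I \<Longrightarrow> i < \<omega>"
    and lin: "\<And>i. i \<in> insert \<omega> I \<Longrightarrow> linear_form (Suc k) (\<Lambda> i)"
  defines "\<Lambda>' \<equiv> (\<lambda>i. Poly_Mapping.single 0 (c \<omega>) * \<Lambda> i - Poly_Mapping.single 0 (c i) * \<Lambda> \<omega>)"
  shows "c \<omega> ^ ((card I - k) * (card I choose k)) * det (product_matrix (Suc k) (insert \<omega> I) \<Lambda>)
    = c \<omega> ^ (card I choose Suc k) * det (product_matrix k I \<Lambda>') * det (product_matrix (Suc k) I \<Lambda>)"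
proof -
  \<comment> \<open>This degree serves both \<open>insert \<omega> I\<close> with
    \<open>Suc k\<close> and \<open>I\<close> with \<open>k\<close>; the family \<open>I\<close>
    with \<open>Suc k\<close> has degree m - 1.\<close>
  define m where "m = int (card I) - int k"
  define P where "P = (card I choose k)"
  define Q where "Q = (card I choose Suc k)"
  let ?S0 = "subset_list I m" and ?S1 = "subset_list I (m - 1)"
  have \<omega>: "\<omega> \<notin> I" using top by blast
  have m1: "int (card I) - int (Suc k) = m - 1" by (simp add: m_def)
  have len: "length (monomial_list k m) = P" "length (monomial_list (Suc k) (m - 1)) = Q"
      "length ?S0 = P" "length ?S1 = Q"
    unfolding m1[symmetric] unfolding m_def P_def Q_def
    by (rule monomial_list(3) subset_list(3)[OF fin])+
  have S0: "?S0 ! i \<in> subsets_of_size I m" if "i < P" for i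
    using that len(3) subset_list(1)[OF fin, of m] by (metis nth_mem)
  have S1: "?S1 ! i \<in> subsets_of_size I (m - 1)" if "i < Q" for i
    using that len(4) subset_list(1)[OF fin, of "m - 1"] by (metis nth_mem)
  have S: "subset_list (insert \<omega> I) m ! i = (if i < P then ?S0 ! i else insert \<omega> (?S1 ! (i - P)))"
    if "i < P + Q" for i
    using that by (simp add: subset_list_insert[OF fin top] nth_append len)
  have red: "linear_form k (\<Lambda>' i)" if "i \<in> I" for i
    unfolding \<Lambda>'_def c_def using that lin by (intro linear_form_reduced) auto
  have split: "Poly_Mapping.single 0 (c \<omega>) * \<Lambda> i = \<Lambda>' i + \<Lambda> \<omega> * Poly_Mapping.single 0 (c i)" for i
    by (simp add: \<Lambda>'_def mult.commute)
  have "\<exists>q \<in> homogeneous (Suc k) (m - 1).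
      (\<Prod>j\<in>?S0 ! i. Poly_Mapping.single 0 (c \<omega>) * \<Lambda> j) = (\<Prod>j\<in>?S0 ! i. \<Lambda>' j) + \<Lambda> \<omega> * q" if "i < P" for i
  proof -
    from S0[OF that] have "finite (?S0 ! i)" "?S0 ! i \<subseteq> I" and m: "int (card (?S0 ! i)) = m"
      by (auto simp: subsets_of_size_def)
    then show ?thesis
      using prod_modulo_linear_form[of "?S0 ! i" "\<Lambda> \<omega>" k \<Lambda>' "\<lambda>i. Poly_Mapping.single 0 (c \<omega>) * \<Lambda> i" c]
        lin red split by (auto simp: subset_iff)
  qed
  then have "\<forall>i. \<exists>q. i < P \<longrightarrow> q \<in> homogeneous (Suc k) (m - 1) \<and>
      (\<Prod>j\<in>?S0 ! i. Poly_Mapping.single 0 (c \<omega>) * \<Lambda> j) = (\<Prod>j\<in>?S0 ! i. \<Lambda>' j) + \<Lambda> \<omega> * q"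
    by blast
  from choice[OF this]
  obtain r where r: "\<And>i. i < P \<Longrightarrow> r i \<in> homogeneous (Suc k) (m - 1)"
    and r_eq: "\<And>i. i < P \<Longrightarrow>
      (\<Prod>j\<in>?S0 ! i. Poly_Mapping.single 0 (c \<omega>) * \<Lambda> j) = (\<Prod>j\<in>?S0 ! i. \<Lambda>' j) + \<Lambda> \<omega> * r i"
    by blast
  \<comment> \<open>The scaled row \<open>i\<close> will be
    \<open>b i + \<Lambda> \<omega> * s i\<close>. A row containing \<open>\<omega>\<close> is left
    unscaled and has \<open>b i = 0\<close>, with the product of its other forms as
    \<open>s i\<close>.\<close>
  define b where "b i = (if i < P then \<Prod>j\<in>?S0 ! i. \<Lambda>' j else 0)" for i
  define s where "s i = (if i < P then r i else \<Prod>j\<in>?S1 ! (i - P). \<Lambda> j)" for i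
  define d where "d i = (if i < P then c \<omega> ^ (card I - k) else 1)" for i :: nat
  have PM: "product_matrix (Suc k) (insert \<omega> I) \<Lambda>
      = mat (P + Q) (P + Q) (\<lambda>(i, j).
          Poly_Mapping.lookup (\<Prod>l\<in>subset_list (insert \<omega> I) m ! i. \<Lambda> l) (monomial_list (Suc k) m ! j))"
    using fin \<omega> by (simp add: product_matrix_def Let_def m_def P_def Q_def)
  have "(\<Prod>i<P + Q. d i) * det (product_matrix (Suc k) (insert \<omega> I) \<Lambda>)
      = det (mat (P + Q) (P + Q) (\<lambda>(i, j). d i * product_matrix (Suc k) (insert \<omega> I) \<Lambda> $$ (i, j)))"
    by (rule det_scale_rows[symmetric]) (simp add: PM)
  also have "mat (P + Q) (P + Q) (\<lambda>(i, j). d i * product_matrix (Suc k) (insert \<omega> I) \<Lambda> $$ (i, j))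
      = mat (P + Q) (P + Q) (\<lambda>(i, j). Poly_Mapping.lookup (b i + \<Lambda> \<omega> * s i) (monomial_list (Suc k) m ! j))"
  proof (rule eq_matI, simp_all, goal_cases)
    case (1 i j)
    have "Poly_Mapping.single 0 (d i) * (\<Prod>l\<in>subset_list (insert \<omega> I) m ! i. \<Lambda> l) = b i + \<Lambda> \<omega> * s i"
    proof (cases "i < P")
      case True
      \<comment> \<open>A set of size m exists, so m >= 0 and the integer degree agrees with the
        truncated difference \<open>card I - k\<close>.\<close>
      from S0[OF True] have "finite (?S0 ! i)" "card (?S0 ! i) = card I - k"
        by (auto simp: subsets_of_size_def m_def)
      then have "Poly_Mapping.single 0 (d i) * (\<Prod>l\<in>?S0 ! i. \<Lambda> l)
          = (\<Prod>j\<in>?S0 ! i. Poly_Mapping.single 0 (c \<omega>) * \<Lambda> j)"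
        using single_prod[of "?S0 ! i" "\<lambda>_. 0 :: monomial" "\<lambda>_. c \<omega>"] True
        by (simp add: prod.distrib d_def)
      then show ?thesis using True 1 by (simp add: S r_eq b_def s_def)
    next
      case False
      with 1 have "i - P < Q" by linarith
      from S1[OF this] have "finite (?S1 ! (i - P))" "\<omega> \<notin> ?S1 ! (i - P)"
        using \<omega> by (auto simp: subsets_of_size_def)
      then show ?thesis using False 1 by (simp add: S b_def s_def d_def)
    qed
    from arg_cong[OF this, of "\<lambda>p. Poly_Mapping.lookup p (monomial_list (Suc k) m ! j)"] show ?case
      using 1 by (simp add: PM lookup_const_times)
  qed
  also have "det \<dots> = det (mat P P (\<lambda>(i, j). Poly_Mapping.lookup (b i) (monomial_list k m ! j)))
      * det (mat Q Q (\<lambda>(i, j). Poly_Mapping.lookup (s (i + P)) (monomial_list (Suc k) (m - 1) ! j)))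
      * c \<omega> ^ Q"
    unfolding c_def len[symmetric]
  proof (rule det_coefficients_split, unfold len)
    show "linear_form (Suc k) (\<Lambda> \<omega>)" using lin by simp
    show "b i \<in> homogeneous k m" if "i < P" for i
      using S0[OF that] that red prod_linear_homogeneous[of "?S0 ! i" \<Lambda>' k]
      by (auto simp: b_def subsets_of_size_def subset_iff)
    show "b i = 0" if "P \<le> i" "i < P + Q" for i using that by (simp add: b_def)
    show "s i \<in> homogeneous (Suc k) (m - 1)" if "i < P + Q" for i
    proof (cases "i < P")
      case False
      with that have "i - P < Q" by linarith
      from S1[OF this] lin prod_linear_homogeneous[of "?S1 ! (i - P)" \<Lambda> "Suc k"] False
      show ?thesis by (auto simp: s_def subsets_of_size_def subset_iff)
    qed (simp add: s_def r)
  qed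
  also have "mat P P (\<lambda>(i, j). Poly_Mapping.lookup (b i) (monomial_list k m ! j)) = product_matrix k I \<Lambda>'"
    by (rule eq_matI) (auto simp: product_matrix_def Let_def b_def P_def m_def)
  also have "mat Q Q (\<lambda>(i, j). Poly_Mapping.lookup (s (i + P)) (monomial_list (Suc k) (m - 1) ! j))
      = product_matrix (Suc k) I \<Lambda>"
    unfolding product_matrix_def Let_def m1 by (rule eq_matI) (auto simp: s_def Q_def)
  also have "(\<Prod>i<P + Q. d i) = c \<omega> ^ ((card I - k) * (card I choose k))"
    by (simp add: d_def prod_if_less power_mult P_def)
  finally show ?thesis by (simp add: Q_def ac_simps)
qed

subsection \<open>The product formula\<close>

lemma det_dim_1: "det (mat (Suc 0) (Suc 0) f) = f (0, 0)" for f :: "_ \<Rightarrow> 'a::comm_ring_1"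
  by (subst det_lower_triangular[of 1]) (auto simp: prod_list_diag_prod)

text \<open>The empty subset and the monomial 1 give the matrix (1). Applied to \<open>J\<close>
  with \<open>card J = Suc k\<close>, this removes the last factor of the recursion for
  \<open>insert \<omega> J\<close>.\<close>

lemma det_product_matrix_card_eq:
  fixes \<Lambda> :: "'i::linorder \<Rightarrow> 'a::comm_ring_1 mpoly"
  assumes "finite I" "card I = n"
  shows "det (product_matrix n I \<Lambda>) = 1"
proof -
  have "subset_list I 0 ! 0 \<in> subsets_of_size I 0"
    using subset_list(3)[OF assms(1), of n] nth_mem[of 0 "subset_list I 0"] assms
    by (simp add: subset_list(1))
  then have "subset_list I 0 ! 0 = {}" by (auto simp: subsets_of_size_def)
  moreover have "monomial_list n 0 ! 0 \<in> monomials n 0"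
    using monomial_list(3)[of n n] nth_mem[of 0 "monomial_list n 0"] by (simp add: monomial_list(1))
  then have "monomial_list n 0 ! 0 = 0"
    by (intro poly_mapping_eqI) (auto simp: monomials_def in_keys_iff subset_iff simp flip: of_nat_sum)
  ultimately show ?thesis
    using assms(2) by (simp add: product_matrix_def det_dim_1)
qed

text \<open>The start of the induction on n: the only row is I itself, the only column is X_0^{|I|},
  and each form is a multiple of X_0.\<close>

lemma det_product_matrix_0:
  fixes \<Lambda> :: "'i::linorder \<Rightarrow> 'a::comm_ring_1 mpoly"
  assumes "finite I" "\<And>i. i \<in> I \<Longrightarrow> linear_form 0 (\<Lambda> i)"
  shows "det (product_matrix 0 I \<Lambda>) = (\<Prod>i\<in>I. Poly_Mapping.lookup (\<Lambda> i) (indeterminate 0))"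
proof -
  have "subset_list I (int (card I)) ! 0 \<in> subsets_of_size I (int (card I))"
    using subset_list(3)[OF assms(1), of 0] nth_mem[of 0 "subset_list I (int (card I))"]
    by (simp add: subset_list(1)[OF assms(1)])
  then have S: "subset_list I (int (card I)) ! 0 = I"
    using assms(1) by (auto simp: subsets_of_size_def dest: card_subset_eq)
  have "monomial_list 0 (int (card I)) ! 0 \<in> monomials 0 (int (card I))"
    using monomial_list(3)[of 0 "card I"] nth_mem[of 0 "monomial_list 0 (int (card I))"]
    by (simp add: monomial_list(1))
  then have e: "monomial_list 0 (int (card I)) ! 0 = (\<Sum>i\<in>I. indeterminate 0)"
    by (intro poly_mapping_eqI, unfold lookup_sum)
      (auto simp: monomials_def in_keys_iff subset_iff lookup_single when_def)
  have "\<Lambda> i = Poly_Mapping.single (indeterminate 0) (Poly_Mapping.lookup (\<Lambda> i) (indeterminate 0))" if "i \<in> I" for i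
    using poly_mapping_sum_singles[of "\<Lambda> i" "monomials 0 1"] assms(2)[OF that]
    by (simp add: homogeneous_def monomials_1)
  then have "(\<Prod>i\<in>I. \<Lambda> i)
      = Poly_Mapping.single (\<Sum>i\<in>I. indeterminate 0) (\<Prod>i\<in>I. Poly_Mapping.lookup (\<Lambda> i) (indeterminate 0))"
    by (subst prod.cong[OF refl], assumption) (simp only: single_prod[OF assms(1)])
  then show ?thesis by (simp add: product_matrix_def Let_def det_dim_1 S e del: sum_constant)
qed

section \<open>Adding a form whose top coefficient is regular\<close>

lemma subsets_of_size_nat:
  "finite I \<Longrightarrow> subsets_of_size I (int k) = {J. J \<subseteq> I \<and> card J = k}"
  by (auto simp: subsets_of_size_def finite_subset)

lemma finite_subsets_of_size: "finite I \<Longrightarrow> finite (subsets_of_size I m)"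
  by (rule finite_subset[of _ "Pow I"]) (auto simp: subsets_of_size_def)

lemma power_regular:
  fixes c :: "'a::comm_ring_1"
  assumes "\<And>y. c * y = 0 \<Longrightarrow> y = 0" "c ^ K * x = c ^ K * y"
  shows "x = y"
proof -
  have "c ^ K * z = 0 \<Longrightarrow> z = 0" for z
    by (induction K) (auto simp: mult.assoc dest: assms(1))
  from this[of "x - y"] assms(2) show ?thesis by (simp add: right_diff_distrib)
qed

text \<open>The recursion is used twice: for \<open>I\<close>, and for each \<open>J\<close> of size
  k + 1, where it turns the factors of the formula for \<open>\<Lambda>'\<close> into determinants
  for \<open>insert \<omega> J\<close>. Both sides acquire the same power of the top coefficient,
  which regularity cancels. Keeping the subfamily determinants as \<open>product_matrix\<close>
  makes the recursion applicable to them.\<close>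

lemma det_product_matrix_insert_regular:
  fixes \<Lambda> :: "'i::linorder \<Rightarrow> 'a::comm_ring_1 mpoly"
  assumes fin: "finite I" and top: "\<And>i. i \<in> I \<Longrightarrow> i < \<omega>"
    and lin: "\<And>i. i \<in> insert \<omega> I \<Longrightarrow> linear_form (Suc k) (\<Lambda> i)"
    and regular: "\<And>y. Poly_Mapping.lookup (\<Lambda> \<omega>) (indeterminate (Suc k)) * y = 0 \<Longrightarrow> y = 0"
    and fewer_vars: "\<And>\<Lambda>' :: 'i \<Rightarrow> 'a mpoly. (\<And>i. i \<in> I \<Longrightarrow> linear_form k (\<Lambda>' i)) \<Longrightarrow>
      det (product_matrix k I \<Lambda>') = (\<Prod>J\<in>subsets_of_size I (int k + 1). det (product_matrix k J \<Lambda>'))"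
    and fewer_forms: "det (product_matrix (Suc k) I \<Lambda>)
      = (\<Prod>J\<in>subsets_of_size I (int (Suc k) + 1). det (product_matrix (Suc k) J \<Lambda>))"
  shows "det (product_matrix (Suc k) (insert \<omega> I) \<Lambda>)
    = (\<Prod>J\<in>subsets_of_size (insert \<omega> I) (int (Suc k) + 1). det (product_matrix (Suc k) J \<Lambda>))"
proof -
  define c where "c i = Poly_Mapping.lookup (\<Lambda> i) (indeterminate (Suc k))" for i
  define \<Lambda>' where "\<Lambda>' i = Poly_Mapping.single 0 (c \<omega>) * \<Lambda> i - Poly_Mapping.single 0 (c i) * \<Lambda> \<omega>" for i
  define S where "S = subsets_of_size I (int (Suc k))"
  define S' where "S' = subsets_of_size I (int (Suc k) + 1)"
  define D where "D J = det (product_matrix (Suc k) J \<Lambda>)" for J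
  have \<omega>: "\<omega> \<notin> I" using top by blast
  have cardS: "card S = (card I choose Suc k)"
    unfolding S_def by (simp add: subsets_of_size_nat fin n_subsets del: of_nat_Suc)
  have SI: "J \<subseteq> I" "finite J" "card J = Suc k" if "J \<in> S" for J
    using that by (auto simp: S_def subsets_of_size_def)
  \<comment> \<open>For \<open>card J = Suc k\<close> the exponents of the recursion are (k + 1 - k)
    binom(k + 1, k) = k + 1 and 1, and the factor for \<open>J\<close> alone is 1.\<close>
  have DS: "c \<omega> * det (product_matrix k J \<Lambda>') = c \<omega> ^ Suc k * D (insert \<omega> J)" if "J \<in> S" for J
  proof -
    have "linear_form (Suc k) (\<Lambda> i)" if "i \<in> insert \<omega> J" for i
      using that lin SI(1)[OF \<open>J \<in> S\<close>] by auto
    then show ?thesis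
      using det_product_matrix_insert[where I = J and \<omega> = \<omega> and k = k and \<Lambda> = \<Lambda>]
        SI[OF that] top det_product_matrix_card_eq[of J "Suc k" \<Lambda>]
      by (auto simp: D_def c_def \<Lambda>'_def[abs_def] subset_iff)
  qed
  have "linear_form k (\<Lambda>' i)" if "i \<in> I" for i
    unfolding \<Lambda>'_def c_def using that lin by (intro linear_form_reduced) auto
  then have B: "det (product_matrix k I \<Lambda>') = (\<Prod>J\<in>S. det (product_matrix k J \<Lambda>'))"
    using fewer_vars by (simp add: S_def add.commute)
  let ?K = "(card I - k) * (card I choose k)"
  \<comment> \<open>The power that scales the rows equals the product of the powers
    \<open>c \<omega> ^ Suc k\<close> contributed by the members of \<open>S\<close>.\<close>
  have K: "?K = Suc k * (card I choose Suc k)"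
    by (simp only: binomial_absorb_comp binomial_absorption)
  have "c \<omega> ^ ?K * det (product_matrix (Suc k) (insert \<omega> I) \<Lambda>)
      = c \<omega> ^ (card I choose Suc k) * det (product_matrix k I \<Lambda>') * det (product_matrix (Suc k) I \<Lambda>)"
    unfolding \<Lambda>'_def[abs_def] c_def by (rule det_product_matrix_insert[OF fin top lin])
  \<comment> \<open>The exponent \<open>card I choose Suc k\<close> is the size of \<open>S\<close>,
    so each \<open>J\<close> receives one factor \<open>c \<omega>\<close>.\<close>
  also have "\<dots> = (\<Prod>J\<in>S. c \<omega> * det (product_matrix k J \<Lambda>')) * (\<Prod>J\<in>S'. D J)"
    by (simp add: B fewer_forms prod.distrib cardS S'_def D_def)
  also have "(\<Prod>J\<in>S. c \<omega> * det (product_matrix k J \<Lambda>')) = (\<Prod>J\<in>S. c \<omega> ^ Suc k * D (insert \<omega> J))"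
    by (rule prod.cong) (simp_all add: DS del: power_Suc)
  also have "\<dots> = c \<omega> ^ ?K * (\<Prod>J\<in>S. D (insert \<omega> J))"
    unfolding K by (simp only: prod.distrib prod_constant cardS power_mult)
  also have "(\<Prod>J\<in>S. D (insert \<omega> J)) = (\<Prod>J\<in>insert \<omega> ` S. D J)"
  proof -
    have "inj_on (insert \<omega>) S"
      using SI(1) \<omega> by (intro inj_onI) (metis insert_ident subsetD)
    then show ?thesis by (simp add: prod.reindex)
  qed
  also have "c \<omega> ^ ?K * (\<Prod>J\<in>insert \<omega> ` S. D J) * (\<Prod>J\<in>S'. D J)
      = c \<omega> ^ ?K * (\<Prod>J\<in>S' \<union> insert \<omega> ` S. D J)"
  proof (subst prod.union_disjoint)
    show "finite S'" "finite (insert \<omega> ` S)"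
      by (simp_all add: S'_def S_def finite_subsets_of_size fin)
    show "S' \<inter> insert \<omega> ` S = {}" using \<omega> by (auto simp: S'_def subsets_of_size_def)
  qed (simp add: ac_simps)
  \<comment> \<open>Among the subsets of size k + 2, those without \<open>\<omega>\<close> form
    \<open>S'\<close> and those with \<open>\<omega>\<close> come from \<open>S\<close>.\<close>
  also have "S' \<union> insert \<omega> ` S = subsets_of_size (insert \<omega> I) (int (Suc k) + 1)"
    using subsets_of_size_insert[OF \<omega>, of "int (Suc k) + 1"] by (simp add: S'_def S_def)
  finally show ?thesis
    using regular unfolding D_def c_def by (rule power_regular[rotated])
qed

section \<open>Cancellation over A[t]\<close>

lemma dvd_det_product_matrix_diff:
  fixes \<Lambda> \<Lambda>' :: "'i::linorder \<Rightarrow> 'a::comm_ring_1 mpoly"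
  assumes "\<And>i. Poly_Mapping.single 0 d dvd \<Lambda>' i - \<Lambda> i"
  shows "d dvd det (product_matrix n I \<Lambda>') - det (product_matrix n I \<Lambda>)"
proof (rule dvd_det_diff[OF product_matrix_carrier product_matrix_carrier])
  fix i j assume "i < (card I choose n)" "j < (card I choose n)"
  moreover have "d dvd Poly_Mapping.lookup (\<Prod>l\<in>\<sigma>. \<Lambda>' l) e - Poly_Mapping.lookup (\<Prod>l\<in>\<sigma>. \<Lambda> l) e" for \<sigma> e
  proof -
    have "Poly_Mapping.single 0 d dvd (\<Prod>l\<in>\<sigma>. \<Lambda>' l) - (\<Prod>l\<in>\<sigma>. \<Lambda> l)"
      by (intro dvd_prod_diff assms)
    then obtain r where r: "(\<Prod>l\<in>\<sigma>. \<Lambda>' l) - (\<Prod>l\<in>\<sigma>. \<Lambda> l) = Poly_Mapping.single 0 d * r" by (rule dvdE)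
    show ?thesis
      unfolding lookup_minus[symmetric] r by (simp add: lookup_const_times)
  qed
  ultimately show "d dvd product_matrix n I \<Lambda>' $$ (i, j) - product_matrix n I \<Lambda> $$ (i, j)"
    by (simp add: product_matrix_def Let_def)
qed

text \<open>The coefficient of \<open>p * y\<close> in degree deg p + deg y is the leading
  coefficient of \<open>y\<close>, even if A has zero divisors.\<close>

lemma monic_regular:
  fixes p y :: "'a::comm_ring_1 poly"
  assumes "lead_coeff p = 1" "p * y = 0"
  shows "y = 0"
  using coeff_mult_degree_sum[of p y] assms by simp

text \<open>Outer induction on n, inner induction on \<open>I\<close> by adding a new maximum. The
  family stays arbitrary in both: the outer hypothesis is applied to reduced forms, the inner one to
  the perturbed family.\<close>

lemma det_product_matrix_poly:
  fixes \<Lambda> :: "'i::linorder \<Rightarrow> 'a::comm_ring_1 poly mpoly"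
  assumes "finite I" "\<And>i. i \<in> I \<Longrightarrow> linear_form n (\<Lambda> i)"
  shows "det (product_matrix n I \<Lambda>)
    = (\<Prod>J\<in>subsets_of_size I (int n + 1). det (product_matrix n J \<Lambda>))"
  using assms
proof (induction n arbitrary: I \<Lambda>)
  case 0
  have sub: "subsets_of_size I (int 0 + 1) = (\<lambda>i. {i}) ` I"
    using subsets_of_size_nat[OF 0(1), of 1] by (auto simp: card_1_singleton_iff)
  have "det (product_matrix 0 {i} \<Lambda>) = Poly_Mapping.lookup (\<Lambda> i) (indeterminate 0)" if "i \<in> I" for i
    using det_product_matrix_0[of "{i}" \<Lambda>] 0(2) that by simp
  then show ?case
    unfolding sub by (simp add: det_product_matrix_0[OF 0] prod.reindex)
next
  case (Suc k)
  note fewer_vars = Suc.IH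
  show ?case
    using Suc.prems
  proof (induction I arbitrary: \<Lambda> rule: finite_linorder_max_induct)
    case empty
    have "subsets_of_size {} (int (Suc k) + 1) = ({} :: 'i set set)" by (auto simp: subsets_of_size_def)
    then show ?case using det_dim_zero[of "product_matrix (Suc k) {} \<Lambda>"] product_matrix_carrier[of "Suc k" "{}" \<Lambda>] by simp
  next
    case (insert \<omega> I)
    let ?L = "\<lambda>\<Lambda>. det (product_matrix (Suc k) (insert \<omega> I) \<Lambda>)"
    let ?R = "\<lambda>\<Lambda>. \<Prod>J\<in>subsets_of_size (insert \<omega> I) (int (Suc k) + 1). det (product_matrix (Suc k) J \<Lambda>)"
    let ?x = "indeterminate (Suc k)"
    let ?a = "Poly_Mapping.lookup (\<Lambda> \<omega>) ?x"
    \<comment> \<open>\<open>N\<close> exceeds the degree of \<open>?a\<close>, which makes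
      \<open>?a + monom 1 N\<close> monic, and the degree of the difference to be shown zero, so
      that divisibility by t^N forces it to vanish. A single such \<open>N\<close> suffices.\<close>
    define N where "N = Suc (max (degree ?a) (degree (?L \<Lambda> - ?R \<Lambda>)))"
    define \<Lambda>N where "\<Lambda>N = \<Lambda>(\<omega> := \<Lambda> \<omega> + Poly_Mapping.single ?x (monom 1 N))"
    have x: "linear_form (Suc k) (Poly_Mapping.single ?x (monom 1 N :: 'a poly))"
      using indeterminate_monomials[of "Suc k" "Suc k"] by (auto simp: homogeneous_def)
    have lin: "linear_form (Suc k) (\<Lambda>N i)" if "i \<in> insert \<omega> I" for i
      using insert.prems[OF that] x by (auto simp: \<Lambda>N_def intro: add_homogeneous)
    have "degree ?a < N" by (simp add: N_def)
    then have "lead_coeff (?a + monom 1 N) = 1"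
      by (simp add: degree_add_eq_right degree_monom_eq coeff_eq_0)
    then have "lead_coeff (Poly_Mapping.lookup (\<Lambda>N \<omega>) ?x) = 1"
      by (simp add: \<Lambda>N_def lookup_add)
    then have "?L \<Lambda>N = ?R \<Lambda>N"
      using insert.hyps lin
      by (intro det_product_matrix_insert_regular fewer_vars insert.IH) (auto dest: monic_regular)
    moreover have single: "Poly_Mapping.single 0 (monom 1 N) dvd \<Lambda>N i - \<Lambda> i" for i
    proof (cases "i = \<omega>")
      case True
      have "Poly_Mapping.single ?x (monom 1 N)
          = Poly_Mapping.single 0 (monom 1 N) * Poly_Mapping.single ?x (1 :: 'a poly)"
        by (simp add: mult_single)
      then have "\<Lambda>N i - \<Lambda> i = Poly_Mapping.single 0 (monom 1 N) * Poly_Mapping.single ?x 1"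
        using True by (simp add: \<Lambda>N_def)
      then show ?thesis by simp
    qed (simp add: \<Lambda>N_def)
    have "monom 1 N dvd ?L \<Lambda>N - ?L \<Lambda>" "monom 1 N dvd ?R \<Lambda>N - ?R \<Lambda>"
      by (intro dvd_prod_diff dvd_det_product_matrix_diff single)+
    \<comment> \<open>The two sides for \<open>\<Lambda>N\<close> are equal and cancel, leaving the
      difference of the two sides for \<open>\<Lambda>\<close>.\<close>
    then have "monom 1 N dvd (?R \<Lambda>N - ?R \<Lambda>) - (?L \<Lambda>N - ?L \<Lambda>)" by (rule dvd_diff[rotated])
    ultimately have "monom 1 N dvd ?L \<Lambda> - ?R \<Lambda>" by simp
    moreover have "degree (?L \<Lambda> - ?R \<Lambda>) < N" by (simp add: N_def)
    ultimately have "lead_coeff (?L \<Lambda> - ?R \<Lambda>) = 0" unfolding monom_1_dvd_iff' by blast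
    then have "?L \<Lambda> - ?R \<Lambda> = 0" by (simp only: leading_coeff_0_iff)
    then show ?case by simp
  qed
qed

text \<open>A embeds in A[t] as the constants. Determinants and products commute with this
  embedding, and injectivity brings the identity back to A.\<close>

lemma det_product_matrix:
  fixes \<Lambda> :: "'i::linorder \<Rightarrow> 'a::comm_ring_1 mpoly"
  assumes "finite I" "\<And>i. i \<in> I \<Longrightarrow> linear_form n (\<Lambda> i)"
  shows "det (product_matrix n I \<Lambda>)
    = (\<Prod>J\<in>subsets_of_size I (int n + 1). det (product_matrix n J \<Lambda>))"
proof -
  let ?h = "\<lambda>a :: 'a. [:a:]"
  interpret h: comm_ring_hom ?h by unfold_locales (auto simp: one_pCons)
  note h = h.comm_ring_hom_axioms
  define \<Lambda>h where "\<Lambda>h i = Poly_Mapping.map ?h (\<Lambda> i)" for i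
  have lift: "det (product_matrix n J \<Lambda>h) = ?h (det (product_matrix n J \<Lambda>))" for J
  proof -
    have "product_matrix n J \<Lambda>h = map_mat ?h (product_matrix n J \<Lambda>)"
      by (rule eq_matI)
        (auto simp: product_matrix_def Let_def \<Lambda>h_def map_hom_prod[OF h, symmetric] lookup_map_hom[OF h])
    then show ?thesis by simp
  qed
  have "linear_form n (\<Lambda>h i)" if "i \<in> I" for i
    by (rule homogeneousI) (simp add: \<Lambda>h_def lookup_map_hom[OF h] homogeneousD[OF assms(2)[OF that]])
  from det_product_matrix_poly[of I \<Lambda>h n, OF assms(1) this] show ?thesis
    by (simp add: lift h.hom_prod[symmetric])
qed

section \<open>Degree 1: subfamilies of n + 1 forms\<close>

lemma monomial_key_indeterminate_less:
  "i < j \<Longrightarrow> j \<le> n \<Longrightarrow> monomial_key n (indeterminate i) < monomial_key n (indeterminate j)"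
  by (induction n) (auto simp: monomial_key_Suc lookup_single when_def le_Suc_eq)

lemma monomial_list_1: "monomial_list n 1 = map indeterminate [0..<Suc n]"
proof (rule strictly_sorted_by_key_unique[where f = "monomial_key n"])
  show "sorted_wrt (\<lambda>x y. monomial_key n x < monomial_key n y) (map indeterminate [0..<Suc n])"
    unfolding sorted_wrt_map
    by (rule sorted_wrt_mono_rel[OF _ sorted_wrt_upt]) (use monomial_key_indeterminate_less in auto)
  show "set (monomial_list n 1) = set (map indeterminate [0..<Suc n])"
    by (simp only: monomial_list(1) monomials_1 set_map set_upt atLeast0LessThan lessThan_Suc_atMost)
qed (simp_all add: monomial_list inj_on_monomial_key)

lemma subset_list_1:
  assumes "finite J"
  shows "subset_list J 1 = map (\<lambda>i. {i}) (sorted_list_of_set J)"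
proof (rule strictly_sorted_by_key_unique[where f = subset_key])
  show "sorted_wrt (\<lambda>x y. subset_key x < subset_key y) (map (\<lambda>i. {i}) (sorted_list_of_set J))"
    using strict_sorted_list_of_set[of J] by (simp add: sorted_wrt_map subset_key_def)
  show "set (subset_list J 1) = set (map (\<lambda>i. {i}) (sorted_list_of_set J))"
    using subsets_of_size_nat[OF assms, of 1] assms
    by (auto simp: subset_list(1) card_1_singleton_iff)
qed (simp_all add: subset_list[OF assms] inj_on_subset_key)

text \<open>Here m = 1: the rows are singletons and the columns are indeterminates, both in
  increasing order. This identifies the factors of the product formula with the determinants of the
  subfamilies.\<close>

lemma product_matrix_card_Suc:
  assumes "finite J" "card J = Suc n"
  shows "product_matrix n J \<Lambda> = form_matrix n J \<Lambda>"
proof -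
  have "int (card J) - int n = 1" using assms(2) by simp
  then show ?thesis
    unfolding product_matrix_def form_matrix_def Let_def
    using assms by (intro eq_matI) (auto simp: subset_list_1 monomial_list_1 simp del: upt_Suc)
qed

theorem proposition1p1:
  fixes n :: nat
    and I :: "'i::linorder set"
    and \<Lambda> :: "'i \<Rightarrow> 'a::comm_ring_1 mpoly"
  assumes "finite I"
    and "\<And>i. i \<in> I \<Longrightarrow> linear_form n (\<Lambda> i)"
  shows "det (product_matrix n I \<Lambda>) =
    (\<Prod>J\<in>subsets_of_size I (int n + 1). det (form_matrix n J \<Lambda>))"
proof -
  have "det (product_matrix n I \<Lambda>) = (\<Prod>J\<in>subsets_of_size I (int n + 1). det (product_matrix n J \<Lambda>))"
    using assms by (rule det_product_matrix)
  also have "\<dots> = (\<Prod>J\<in>subsets_of_size I (int n + 1). det (form_matrix n J \<Lambda>))"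
    by (rule prod.cong) (auto simp: subsets_of_size_def product_matrix_card_Suc)
  finally show ?thesis .
qed

end
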